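(* Let $f^0(x,y)$ be a curvature surface on $D=\{(x,y)\in\mathbb{R}^2:x>0\}$ with frame field $F^0=[\phi,X^0_\alpha,X^0_\beta,\xi]$, and let $A(y)$, $\tilde A(x)$ and the orthonormal base $[\boldsymbol{b}^\infty,\boldsymbol{c}^\infty,\tilde{\boldsymbol{b}}^\infty,\tilde{\boldsymbol{c}}^\infty]$ of $\mathbb{R}^4$ be as in the context. (1) The curve $A(y)$ lies on an affine plane spanned by (i.e. parallel to) $\tilde{\boldsymbol{b}}^\infty$ and $\tilde{\boldsymbol{c}}^\infty$. (2) The curve $\tilde A(x)$ lies on an affine plane spanned by (i.e. parallel to) $\boldsymbol{b}^\infty$ and $\boldsymbol{c}^\infty$.
   Context: $X_0(x)=\frac52+\sum_{k\ge1}a_kx^{2k}$ (analytic on $\mathbb{R}$), $a_1=1$, $2(k+1)(4k^2+\frac54)a_{k+1}+(2k-1)a_k=0$ $(k\ge1)$. $h(x,y)=2X_0-xX_0'+y^2\frac{X_0'}{x}+\sqrt5$ (positive). $B_2(x)=-\frac12\frac{X_0'}{x}-\sqrt5$, $C_2(x)=X_0''-\frac{X_0'}{x}$. On $D$ put $a_1=\frac{2y}{xh}(X_0+\frac{\sqrt5}{2})$, $b_1=-\frac{1}{xh}(X_0+\frac{\sqrt5}{2}+\sqrt5(x^2-y^2))$, $c_1=-\frac{2}{xh}(X_0+\frac{\sqrt5}{2})$, $a_2=-\frac1h(2X_0+\sqrt5-(x^2+y^2)\frac{X_0'}{x})$, $b_2=-\frac{2y}{h}(\frac{X_0'}{2x}+\sqrt5)$,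 $c_2=\frac{2y}{h}(X_0''-\frac{X_0'}{x})$. The frame field is an analytic orthonormal frame field $F^0=[\phi,X^0_\alpha,X^0_\beta,\xi]$ of $\mathbb{R}^4$ on $D$ satisfying $\phi_x=-a_1X^0_\alpha$, $\xi_x=b_1X^0_\alpha$, $(X^0_\beta)_x=c_1X^0_\alpha$, $(X^0_\alpha)_x=a_1\phi-b_1\xi-c_1X^0_\beta$, $\phi_y=-a_2X^0_\beta$, $\xi_y=b_2X^0_\beta$, $(X^0_\alpha)_y=c_2X^0_\beta$, $(X^0_\beta)_y=a_2\phi-b_2\xi-c_2X^0_\alpha$ (it exists and is unique up to left multiplication by a constant orthogonal matrix). The curvature surface $f^0:D\to\mathbb{R}^4$ determined by $F^0$ is the analytic map, unique up to translation, with $df^0=\frac{x^2-y^2}{xh}X^0_\alpha dx+\frac{2y}{h}X^0_\beta dy$. $A(y)=f^0(x,y)-\frac{1}{2\sqrt5(1+y^2)}(X^0_\beta-2(1+y^2)\xi+y\phi)(x,y)$ is independent of $x$ (center of the $2$-sphere containing the $x$-curve); $\tilde A(x)=f^0(x,y)-(B_2^2+C_2^2)^{-1}(x)(B_2\xi+C_2X^0_\alpha)(x,y)$ is independent of $y$ (center of the $2$-sphere containing the $y$-curve). $(\boldsymbol{b}^\infty,\boldsymbol{c}^\infty)$ is the orthonormal pair of constant vectors such that $X^0_\alpha(e^{-u},y)-(\cos\frac{\sqrt5u}{2}\boldsymbol{b}^\infty-\sin\frac{\sqrt5u}{2}\boldsymbol{c}^\infty)\to0$ as $u\to\infty$ for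 every $y$. $(\tilde{\boldsymbol{b}}^\infty,\tilde{\boldsymbol{c}}^\infty)$ is the orthonormal pair of constant vectors such that $(1+y^2)^{-1/2}(yX^0_\beta-\phi)(x,y)=-\sin(y-\arctan y)\,\tilde{\boldsymbol{b}}^\infty+\cos(y-\arctan y)\,\tilde{\boldsymbol{c}}^\infty$ for all $(x,y)\in D$. Together they form an orthonormal base of $\mathbb{R}^4$. *)

theory Defs
  imports "HOL-Analysis.Analysis"
begin

text \<open>
  All functions on the half plane \<open>D\<close> are total functions on \<open>real \<times> real\<close>; only their
  values on \<open>D\<close> are constrained.
\<close>

definition D :: "(real \<times> real) set" where
  "D = {(x, y). x > 0}"

subsection \<open>The function \<open>X\<^sub>0\<close> and the coefficient functions\<close>

fun X0_coeff :: "nat \<Rightarrow> real" where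
  "X0_coeff 0 = 5 / 2"
| "X0_coeff (Suc 0) = 1"
| "X0_coeff (Suc (Suc k)) =
     - (2 * real (Suc k) - 1) / (2 * (real (Suc k) + 1) * (4 * (real (Suc k))\<^sup>2 + 5 / 4))
       * X0_coeff (Suc k)"

lemma X0_coeff_recurrence:
  assumes "k \<ge> 1"
  shows "2 * (real k + 1) * (4 * (real k)\<^sup>2 + 5 / 4) * X0_coeff (k + 1)
         + (2 * real k - 1) * X0_coeff k = 0"
proof -
  obtain j where k: "k = Suc j"
    using assms by (cases k) auto
  have *: "p * (- q / p * a) + q * a = 0" if "p \<noteq> 0" for p q a :: real
    using that by simp
  have "0 < 4 * (real (Suc j))\<^sup>2 + 5 / 4"
    by (rule add_nonneg_pos) auto
  then have "2 * (real (Suc j) + 1) * (4 * (real (Suc j))\<^sup>2 + 5 / 4) \<noteq> 0"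
    by simp
  from *[OF this, of "2 * real (Suc j) - 1" "X0_coeff (Suc j)"] show ?thesis
    unfolding k Suc_eq_plus1[symmetric] X0_coeff.simps .
qed

definition X0 :: "real \<Rightarrow> real" where
  "X0 x = 5 / 2 + (\<Sum>k. X0_coeff (Suc k) * x ^ (2 * Suc k))"

abbreviation X0' :: "real \<Rightarrow> real" where
  "X0' \<equiv> deriv X0"

abbreviation X0'' :: "real \<Rightarrow> real" where
  "X0'' \<equiv> deriv (deriv X0)"

definition h :: "real \<Rightarrow> real \<Rightarrow> real" where
  "h x y = 2 * X0 x - x * X0' x + y\<^sup>2 * (X0' x / x) + sqrt 5"

definition B2 :: "real \<Rightarrow> real" where
  "B2 x = - (1 / 2) * (X0' x / x) - sqrt 5"

definition C2 :: "real \<Rightarrow> real" where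
  "C2 x = X0'' x - X0' x / x"

definition a1 :: "real \<Rightarrow> real \<Rightarrow> real" where
  "a1 x y = 2 * y / (x * h x y) * (X0 x + sqrt 5 / 2)"

definition b1 :: "real \<Rightarrow> real \<Rightarrow> real" where
  "b1 x y = - (1 / (x * h x y)) * (X0 x + sqrt 5 / 2 + sqrt 5 * (x\<^sup>2 - y\<^sup>2))"

definition c1 :: "real \<Rightarrow> real \<Rightarrow> real" where
  "c1 x y = - (2 / (x * h x y)) * (X0 x + sqrt 5 / 2)"

definition a2 :: "real \<Rightarrow> real \<Rightarrow> real" where
  "a2 x y = - (1 / h x y) * (2 * X0 x + sqrt 5 - (x\<^sup>2 + y\<^sup>2) * (X0' x / x))"

definition b2 :: "real \<Rightarrow> real \<Rightarrow> real" where
  "b2 x y = - (2 * y / h x y) * (X0' x / (2 * x) + sqrt 5)"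

definition c2 :: "real \<Rightarrow> real \<Rightarrow> real" where
  "c2 x y = 2 * y / h x y * (X0'' x - X0' x / x)"

subsection \<open>The frame field and the curvature surface\<close>

text \<open>Real analyticity in two variables: near every point of \<open>S\<close> the function is the sum of an
  (unconditionally convergent) double power series.\<close>

definition real_analytic_on :: "(real \<times> real \<Rightarrow> 'a::real_normed_vector) \<Rightarrow> (real \<times> real) set \<Rightarrow> bool"
  where
  "real_analytic_on g S \<longleftrightarrow>
     (\<forall>(x0, y0)\<in>S. \<exists>r>0. \<exists>c :: nat \<Rightarrow> nat \<Rightarrow> 'a.
        \<forall>x y. \<bar>x - x0\<bar> < r \<and> \<bar>y - y0\<bar> < r \<longrightarrow>
          ((\<lambda>(i, j). ((x - x0) ^ i * (y - y0) ^ j) *\<^sub>R c i j) has_sum g (x, y)) UNIV)"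

definition orthonormal :: "'a::real_inner list \<Rightarrow> bool" where
  "orthonormal vs \<longleftrightarrow>
     (\<forall>i<length vs. \<forall>j<length vs. vs ! i \<bullet> vs ! j = (if i = j then 1 else 0))"

definition frame_field ::
  "(real \<times> real \<Rightarrow> real ^ 4) \<Rightarrow> (real \<times> real \<Rightarrow> real ^ 4) \<Rightarrow>
   (real \<times> real \<Rightarrow> real ^ 4) \<Rightarrow> (real \<times> real \<Rightarrow> real ^ 4) \<Rightarrow> bool" where
  "frame_field \<phi> X\<alpha> X\<beta> \<xi> \<longleftrightarrow>
     real_analytic_on \<phi> D \<and> real_analytic_on X\<alpha> D \<and>
     real_analytic_on X\<beta> D \<and> real_analytic_on \<xi> D \<and>
     (\<forall>p\<in>D. orthonormal [\<phi> p, X\<alpha> p, X\<beta> p, \<xi> p]) \<and>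
     (\<forall>(x, y)\<in>D.
        ((\<lambda>s. \<phi> (s, y)) has_vector_derivative - a1 x y *\<^sub>R X\<alpha> (x, y)) (at x) \<and>
        ((\<lambda>s. \<xi> (s, y)) has_vector_derivative b1 x y *\<^sub>R X\<alpha> (x, y)) (at x) \<and>
        ((\<lambda>s. X\<beta> (s, y)) has_vector_derivative c1 x y *\<^sub>R X\<alpha> (x, y)) (at x) \<and>
        ((\<lambda>s. X\<alpha> (s, y)) has_vector_derivative
           a1 x y *\<^sub>R \<phi> (x, y) - b1 x y *\<^sub>R \<xi> (x, y) - c1 x y *\<^sub>R X\<beta> (x, y)) (at x) \<and>
        ((\<lambda>t. \<phi> (x, t)) has_vector_derivative - a2 x y *\<^sub>R X\<beta> (x, y)) (at y) \<and>
        ((\<lambda>t. \<xi> (x, t)) has_vector_derivative b2 x y *\<^sub>R X\<beta> (x, y)) (at y) \<and>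
        ((\<lambda>t. X\<alpha> (x, t)) has_vector_derivative c2 x y *\<^sub>R X\<beta> (x, y)) (at y) \<and>
        ((\<lambda>t. X\<beta> (x, t)) has_vector_derivative
           a2 x y *\<^sub>R \<phi> (x, y) - b2 x y *\<^sub>R \<xi> (x, y) - c2 x y *\<^sub>R X\<alpha> (x, y)) (at y))"

definition curvature_surface ::
  "(real \<times> real \<Rightarrow> real ^ 4) \<Rightarrow> (real \<times> real \<Rightarrow> real ^ 4) \<Rightarrow>
   (real \<times> real \<Rightarrow> real ^ 4) \<Rightarrow> bool" where
  "curvature_surface X\<alpha> X\<beta> f \<longleftrightarrow>
     real_analytic_on f D \<and>
     (\<forall>(x, y)\<in>D.
        (f has_derivative
           (\<lambda>(dx, dy). ((x\<^sup>2 - y\<^sup>2) / (x * h x y) * dx) *\<^sub>R X\<alpha> (x, y)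
                     + (2 * y / h x y * dy) *\<^sub>R X\<beta> (x, y))) (at (x, y)))"

subsection \<open>The two curves of centers\<close>

text \<open>The right-hand sides do not depend on the other coordinate when \<open>f\<close> is the curvature
  surface of the frame; the centers are the resulting common values. In any other case the
  description is unspecified.\<close>

definition center_A ::
  "(real \<times> real \<Rightarrow> real ^ 4) \<Rightarrow> (real \<times> real \<Rightarrow> real ^ 4) \<Rightarrow> (real \<times> real \<Rightarrow> real ^ 4) \<Rightarrow>
   (real \<times> real \<Rightarrow> real ^ 4) \<Rightarrow> real \<Rightarrow> real ^ 4" where
  "center_A f \<phi> X\<beta> \<xi> y =
     (THE a. \<forall>x>0. a = f (x, y) - (1 / (2 * sqrt 5 * (1 + y\<^sup>2))) *\<^sub>R
        (X\<beta> (x, y) - (2 * (1 + y\<^sup>2)) *\<^sub>R \<xi> (x, y) + y *\<^sub>R \<phi> (x, y)))"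

definition center_A_tilde ::
  "(real \<times> real \<Rightarrow> real ^ 4) \<Rightarrow> (real \<times> real \<Rightarrow> real ^ 4) \<Rightarrow> (real \<times> real \<Rightarrow> real ^ 4) \<Rightarrow>
   real \<Rightarrow> real ^ 4" where
  "center_A_tilde f X\<alpha> \<xi> x =
     (THE a. \<forall>y. a = f (x, y) - inverse ((B2 x)\<^sup>2 + (C2 x)\<^sup>2) *\<^sub>R
        (B2 x *\<^sub>R \<xi> (x, y) + C2 x *\<^sub>R X\<alpha> (x, y)))"

end

theory Submission
  imports Defs
begin

text \<open>
  The vector \<open>V = C\<^sub>2 \<xi> - B\<^sub>2 X\<^sub>\<alpha>\<close> does not depend on \<open>y\<close>, the vector
  \<open>U = y X\<^sub>\<beta> - \<phi>\<close> does not depend on \<open>x\<close>, and \<open>U\<close> is orthogonal to \<open>V\<close>. The vectors \<open>U(y)\<close> span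
  the plane of \<open>bt\<close> and \<open>ct\<close>. Since \<open>C\<^sub>2 / B\<^sub>2 \<rightarrow> 0\<close> as \<open>x \<rightarrow> 0\<close>, a vector orthogonal to all \<open>V(x)\<close> is
  asymptotically orthogonal to \<open>X\<^sub>\<alpha>\<close>, hence to \<open>b\<close> and \<open>c\<close>. So the two planes are orthogonal
  complements. Now \<open>A(y) \<bullet> V(x) = f \<bullet> V + C\<^sub>2 / \<surd>5\<close> is independent of \<open>y\<close>, because \<open>f\<^sub>y\<close> is parallel to
  \<open>X\<^sub>\<beta>\<close>, and likewise the product of the other center with \<open>U(y)\<close> is \<open>f \<bullet> U\<close>, which is independent
  of \<open>x\<close>. The other center is well defined because \<open>B\<^sub>2 < 0\<close>, which follows from \<open>X\<^sub>0' / x > 0\<close>.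
\<close>

section \<open>The power series\<close>

text \<open>From index 1 on, consecutive coefficients shrink by a factor of at most
  \<open>1 / (m + 1)\<close>, because \<open>2 * m - 1 \<le> 2 * (4 * m\<^sup>2 + 5 / 4)\<close>.
  The resulting factorial decay makes the series converge everywhere.\<close>

lemma abs_X0_coeff_le: "\<bar>X0_coeff n\<bar> \<le> 5 / 2 / fact n"
proof (induction n rule: X0_coeff.induct)
  case (3 k)
  define m where "m = real (Suc k)"
  have m: "m \<ge> 1" by (simp add: m_def)
  have "\<bar>X0_coeff (Suc (Suc k))\<bar> =
      (2 * m - 1) / (2 * (m + 1) * (4 * m\<^sup>2 + 5 / 4)) * \<bar>X0_coeff (Suc k)\<bar>"
    unfolding X0_coeff.simps m_def[symmetric] using m by (simp add: abs_mult add_nonneg_nonneg)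
  also have "\<dots> \<le> 1 / (m + 1) * (5 / 2 / fact (Suc k))"
  proof (rule mult_mono)
    have "m \<le> m\<^sup>2"
      using m by (rule self_le_power) simp
    then have "(2 * m - 1) / (2 * (4 * m\<^sup>2 + 5 / 4)) \<le> 1"
      using m by (subst pos_divide_le_eq) auto
    from divide_right_mono[OF this, of "m + 1"] m
    show "(2 * m - 1) / (2 * (m + 1) * (4 * m\<^sup>2 + 5 / 4)) \<le> 1 / (m + 1)"
      by (simp add: mult_ac del: distrib_left_numeral distrib_right_numeral)
  qed (use 3 m in auto)
  also have "\<dots> = 5 / 2 / fact (Suc (Suc k))"
    by (simp add: m_def field_simps)
  finally show ?case .
qed auto

lemma summable_X0_coeff: "summable (\<lambda>n. X0_coeff n * t ^ n)" for t :: real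
proof (rule summable_comparison_test')
  show "summable (\<lambda>n. 5 / 2 * (inverse (fact n) * \<bar>t\<bar> ^ n))"
    by (intro summable_mult summable_exp)
  show "norm (X0_coeff n * t ^ n) \<le> 5 / 2 * (inverse (fact n) * \<bar>t\<bar> ^ n)" for n
    using mult_right_mono[OF abs_X0_coeff_le[of n], of "\<bar>t\<bar> ^ n"]
    by (simp add: abs_mult power_abs field_simps)
qed

text \<open>The \<open>j\<close>-th derivative of the series in the variable
  \<open>t = x\<^sup>2\<close> instead of \<open>x\<close>. In this variable
  \<open>X0' x / x\<close> becomes \<open>2 * X0_powser 1 (x\<^sup>2)\<close>, which is regular at
  \<open>0\<close>.\<close>

definition X0_powser :: "nat \<Rightarrow> real \<Rightarrow> real" where
  "X0_powser j t = (\<Sum>n. (diffs ^^ j) X0_coeff n * t ^ n)"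

lemma summable_X0_powser: "summable (\<lambda>n. (diffs ^^ j) X0_coeff n * t ^ n)" for t :: real
  by (induction j arbitrary: t) (auto intro: summable_X0_coeff termdiff_converges_all)

lemma X0_powser_sums: "(\<lambda>n. (diffs ^^ j) X0_coeff n * t ^ n) sums X0_powser j t"
  unfolding X0_powser_def by (intro summable_sums summable_X0_powser)

lemma has_real_derivative_X0_powser [derivative_intros]:
  assumes "(g has_real_derivative g') (at x within S)"
  shows "((\<lambda>x. X0_powser j (g x)) has_real_derivative X0_powser (Suc j) (g x) * g') (at x within S)"
proof -
  have "(X0_powser j has_real_derivative X0_powser (Suc j) t) (at t)" for t
    unfolding X0_powser_def funpow.simps comp_def
    by (rule termdiffs_strong_converges_everywhere) (rule summable_X0_powser)
  then show ?thesis
    using DERIV_chain2 assms by blast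
qed

lemma continuous_on_X0_powser: "continuous_on S (X0_powser j)"
  by (rule DERIV_continuous_on[where D = "X0_powser (Suc j)"])
    (auto intro!: derivative_eq_intros)

lemma X0_powser_0: "X0_powser j 0 = (diffs ^^ j) X0_coeff 0"
  unfolding X0_powser_def by simp

lemma X0_eq_powser: "X0 x = X0_powser 0 (x\<^sup>2)"
  using suminf_split_head[OF summable_X0_powser[of 0 "x\<^sup>2"]]
  unfolding X0_def X0_powser_def power_mult by simp

lemma deriv_X0: "X0' x = 2 * x * X0_powser 1 (x\<^sup>2)"
  by (rule DERIV_imp_deriv, subst X0_eq_powser[abs_def])
    (auto intro!: derivative_eq_intros)

lemma deriv_deriv_X0: "X0'' x = 2 * X0_powser 1 (x\<^sup>2) + 4 * x\<^sup>2 * X0_powser 2 (x\<^sup>2)"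
  by (rule DERIV_imp_deriv, subst deriv_X0[abs_def])
    (auto intro!: derivative_eq_intros simp: power2_eq_square numeral_2_eq_2)

lemma B2_eq: "x \<noteq> 0 \<Longrightarrow> B2 x = - X0_powser 1 (x\<^sup>2) - sqrt 5"
  by (simp add: B2_def deriv_X0)

lemma C2_eq: "x \<noteq> 0 \<Longrightarrow> C2 x = 4 * x\<^sup>2 * X0_powser 2 (x\<^sup>2)"
  by (simp add: C2_def deriv_X0 deriv_deriv_X0)

text \<open>The coefficient of \<open>t ^ n\<close> on the left is \<open>n + 1\<close> times the
  recurrence at index \<open>n + 1\<close>.\<close>

lemma X0_powser_ode:
  "8 * t\<^sup>2 * X0_powser 4 t + 24 * t * X0_powser 3 t + (21 / 2 + 2 * t) * X0_powser 2 t
    + X0_powser 1 t = 0"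
proof -
  define c where "c j = (diffs ^^ j) X0_coeff" for j
  have c_Suc: "c (Suc j) n = real (Suc n) * c j (Suc n)" for j n
    by (simp add: c_def diffs_def)
  have sums: "(\<lambda>n. c j n * t ^ n) sums X0_powser j t" for j
    unfolding c_def by (rule X0_powser_sums)
  \<comment> \<open>Multiplication by \<open>t\<close> raises the exponent by one, and the factor
    \<open>real n\<close> kills the term at index \<open>0\<close>; so \<open>t\<close> times
    differentiation just multiplies coefficients by \<open>n\<close>.\<close>
  have shift: "(\<lambda>n. real n * c j n * t ^ n) sums (t * X0_powser (Suc j) t)" for j
    using sums_mult[OF sums[of "Suc j"], of t]
      sums_Suc_iff[of "\<lambda>n. real n * c j n * t ^ n" "t * X0_powser (Suc j) t"]
    by (simp add: c_Suc mult_ac)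
  have shift2: "(\<lambda>n. (real n - 1) * real n * c j n * t ^ n) sums (t\<^sup>2 * X0_powser (Suc (Suc j)) t)"
    for j
    using sums_mult[OF shift[of "Suc j"], of t]
      sums_Suc_iff[of "\<lambda>n. (real n - 1) * real n * c j n * t ^ n"
        "t\<^sup>2 * X0_powser (Suc (Suc j)) t"]
    by (simp add: c_Suc mult_ac power2_eq_square)
  have "(\<lambda>n. 8 * ((real n - 1) * real n * c 2 n * t ^ n) + 24 * (real n * c 2 n * t ^ n)
        + 21 / 2 * (c 2 n * t ^ n) + 2 * (real n * c 1 n * t ^ n) + c 1 n * t ^ n) sums
      (8 * (t\<^sup>2 * X0_powser (Suc (Suc 2)) t) + 24 * (t * X0_powser (Suc 2) t)
        + 21 / 2 * X0_powser 2 t + 2 * (t * X0_powser (Suc 1) t) + X0_powser 1 t)"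
    by (intro sums_add sums_mult shift shift2 sums)
  moreover have "8 * ((real n - 1) * real n * c 2 n * t ^ n) + 24 * (real n * c 2 n * t ^ n)
        + 21 / 2 * (c 2 n * t ^ n) + 2 * (real n * c 1 n * t ^ n) + c 1 n * t ^ n = 0" for n
  proof -
    define N p q where "N = real n" and "p = X0_coeff (Suc n)" and "q = X0_coeff (Suc (Suc n))"
    have "2 * (N + 2) * (4 * (N + 1)\<^sup>2 + 5 / 4) * q + (2 * N + 1) * p = 0"
      using X0_coeff_recurrence[of "Suc n"] unfolding Suc_eq_plus1[symmetric] N_def p_def q_def
      by (simp add: algebra_simps del: X0_coeff.simps)
    moreover have "c 1 n = (N + 1) * p" "c 2 n = (N + 1) * (N + 2) * q"
      by (simp_all add: c_def diffs_def N_def p_def q_def numeral_2_eq_2 algebra_simps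
          del: X0_coeff.simps)
    ultimately have "8 * ((N - 1) * N * c 2 n) + 24 * (N * c 2 n) + 21 / 2 * c 2 n
        + 2 * (N * c 1 n) + c 1 n = 0"
      by algebra
    then have "(8 * ((N - 1) * N * c 2 n) + 24 * (N * c 2 n) + 21 / 2 * c 2 n
        + 2 * (N * c 1 n) + c 1 n) * t ^ n = 0"
      by simp
    then show ?thesis
      by (simp add: N_def algebra_simps)
  qed
  ultimately have "(\<lambda>n. 0) sums (8 * (t\<^sup>2 * X0_powser (Suc (Suc 2)) t) + 24 * (t * X0_powser (Suc 2) t)
        + 21 / 2 * X0_powser 2 t + 2 * (t * X0_powser (Suc 1) t) + X0_powser 1 t)"
    by (simp only:)
  then have "8 * (t\<^sup>2 * X0_powser (Suc (Suc 2)) t) + 24 * (t * X0_powser (Suc 2) t)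
        + 21 / 2 * X0_powser 2 t + 2 * (t * X0_powser (Suc 1) t) + X0_powser 1 t = 0"
    by (rule sums_unique2[OF _ sums_zero])
  then show ?thesis
    by (simp add: eval_nat_numeral algebra_simps)
qed

text \<open>The ODE is the symmetric square of a second-order equation, whose Wronskian yields this
  first integral.\<close>

lemma X0_powser_first_integral:
  "8 * X0_powser 1 t * (t\<^sup>2 * X0_powser 3 t + t * X0_powser 2 t) - 4 * t\<^sup>2 * (X0_powser 2 t)\<^sup>2
    + (5 / 4 + t) * (X0_powser 1 t)\<^sup>2 = 5 / 4"
proof -
  define E where "E t = 8 * X0_powser 1 t * (t\<^sup>2 * X0_powser 3 t + t * X0_powser 2 t)
    - 4 * t\<^sup>2 * (X0_powser 2 t)\<^sup>2 + (5 / 4 + t) * (X0_powser 1 t)\<^sup>2" for t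
  have Suc: "Suc 2 = 3" "Suc 3 = 4" "Suc 1 = 2" by auto
  \<comment> \<open>The ODE reappears with integrating factor \<open>X0_powser 1 t\<close>: the
    terms with \<open>(X0_powser 2 t)\<^sup>2\<close> and
    \<open>X0_powser 2 t * X0_powser 3 t\<close> cancel.\<close>
  have "(E has_real_derivative X0_powser 1 t * (8 * t\<^sup>2 * X0_powser 4 t + 24 * t * X0_powser 3 t
      + (21 / 2 + 2 * t) * X0_powser 2 t + X0_powser 1 t)) (at t)" for t
    unfolding E_def
    by (rule derivative_eq_intros refl | unfold Suc)+
      (simp add: algebra_simps power2_eq_square)
  then have "(E has_real_derivative 0) (at t)" for t
    unfolding X0_powser_ode by simp
  then have "E t = E 0"
    using DERIV_isconst_all by blast
  also have "E 0 = 5 / 4"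
    by (simp add: E_def X0_powser_0 diffs_def)
  finally show ?thesis
    by (simp add: E_def)
qed

text \<open>The value at \<open>0\<close> is \<open>1\<close>, so losing positivity would force a
  zero, where the first integral equates minus a square with \<open>5 / 4\<close>.\<close>

lemma X0_powser_1_pos: "X0_powser 1 t > 0" if "t \<ge> 0"
proof (rule ccontr)
  assume "\<not> X0_powser 1 t > 0"
  then have "X0_powser 1 t \<le> 0" "0 \<le> X0_powser 1 0"
    by (simp_all add: X0_powser_0 diffs_def)
  from IVT2'[OF this that continuous_on_X0_powser] obtain s where "X0_powser 1 s = 0"
    by blast
  with X0_powser_first_integral[of s] have "- (2 * s * X0_powser 2 s)\<^sup>2 = 5 / 4"
    by (simp add: power_mult_distrib)
  then show False
    using zero_le_power2[of "2 * s * X0_powser 2 s"] by linarith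
qed

lemma B2_neg: "x > 0 \<Longrightarrow> B2 x < 0"
  using add_pos_pos[OF X0_powser_1_pos[of "x\<^sup>2"], of "sqrt 5"] by (simp add: B2_eq)

text \<open>\<open>C2\<close> carries a factor \<open>x\<^sup>2\<close>, while \<open>B2\<close>
  tends to \<open>- 1 - sqrt 5\<close>.\<close>

lemma C2_over_B2_tendsto_0: "((\<lambda>x. C2 x / B2 x) \<longlongrightarrow> 0) (at_right 0)"
proof -
  have "isCont (\<lambda>x. 4 * x\<^sup>2 * X0_powser 2 (x\<^sup>2) / (- X0_powser 1 (x\<^sup>2) - sqrt 5)) 0"
  proof -
    have "isCont (\<lambda>x. X0_powser j (x\<^sup>2)) 0" for j
      by (rule DERIV_isCont) (auto intro!: derivative_eq_intros)
    moreover have "- X0_powser 1 0 - sqrt 5 \<noteq> 0"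
      using add_pos_pos[OF X0_powser_1_pos[of 0], of "sqrt 5"] by simp
    ultimately show ?thesis
      by (intro continuous_intros) auto
  qed
  then have "((\<lambda>x. 4 * x\<^sup>2 * X0_powser 2 (x\<^sup>2) / (- X0_powser 1 (x\<^sup>2) - sqrt 5)) \<longlongrightarrow> 0) (at_right 0)"
    unfolding isCont_def by (simp add: filterlim_at_split)
  then show ?thesis
    by (rule Lim_transform_eventually)
      (auto simp: B2_eq C2_eq intro!: eventually_at_rightI[of 0 1])
qed

section \<open>Orthonormal frames\<close>

lemma orthonormal_2:
  "orthonormal [v, w] \<longleftrightarrow> v \<bullet> v = 1 \<and> w \<bullet> w = 1 \<and> v \<bullet> w = 0"
  unfolding orthonormal_def by (auto simp: less_Suc_eq all_conj_distrib inner_commute[of w v])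

lemma orthonormal_4:
  assumes "orthonormal [v1, v2, v3, v4]"
  shows "v1 \<bullet> v2 = 0" "v1 \<bullet> v3 = 0" "v1 \<bullet> v4 = 0" "v2 \<bullet> v3 = 0" "v2 \<bullet> v4 = 0" "v3 \<bullet> v4 = 0"
    "v1 \<bullet> v1 = 1" "v2 \<bullet> v2 = 1" "v3 \<bullet> v3 = 1" "v4 \<bullet> v4 = 1"
    "v2 \<bullet> v1 = 0" "v3 \<bullet> v1 = 0" "v4 \<bullet> v1 = 0" "v3 \<bullet> v2 = 0" "v4 \<bullet> v2 = 0" "v4 \<bullet> v3 = 0"
proof -
  note * = assms[unfolded orthonormal_def, rule_format]
  show "v1 \<bullet> v2 = 0" "v1 \<bullet> v3 = 0" "v1 \<bullet> v4 = 0" "v2 \<bullet> v3 = 0" "v2 \<bullet> v4 = 0" "v3 \<bullet> v4 = 0"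
    using *[of 0 1] *[of 0 2] *[of 0 3] *[of 1 2] *[of 1 3] *[of 2 3] by simp_all
  then show "v2 \<bullet> v1 = 0" "v3 \<bullet> v1 = 0" "v4 \<bullet> v1 = 0" "v3 \<bullet> v2 = 0" "v4 \<bullet> v2 = 0" "v4 \<bullet> v3 = 0"
    by (simp_all add: inner_commute)
  show "v1 \<bullet> v1 = 1" "v2 \<bullet> v2 = 1" "v3 \<bullet> v3 = 1" "v4 \<bullet> v4 = 1"
    using *[of 0 0] *[of 1 1] *[of 2 2] *[of 3 3] by simp_all
qed

text \<open>Four orthonormal vectors span the space by dimension, and the remainder \<open>r\<close>
  of \<open>n\<close> is orthogonal to all of them, hence to itself.\<close>

lemma in_span_if_orthogonal_complement:
  fixes v1 v2 w1 w2 n :: "real ^ 4"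
  assumes v: "orthonormal [v1, v2]" and w: "orthonormal [w1, w2]"
    and vw: "v1 \<bullet> w1 = 0" "v1 \<bullet> w2 = 0" "v2 \<bullet> w1 = 0" "v2 \<bullet> w2 = 0"
    and n: "n \<bullet> v1 = 0" "n \<bullet> v2 = 0"
  shows "n \<in> span {w1, w2}"
proof -
  note o = v[unfolded orthonormal_2] w[unfolded orthonormal_2] vw
  define r where "r = n - (n \<bullet> w1) *\<^sub>R w1 - (n \<bullet> w2) *\<^sub>R w2"
  have r: "r \<bullet> v1 = 0" "r \<bullet> v2 = 0" "r \<bullet> w1 = 0" "r \<bullet> w2 = 0"
    using o n by (simp_all add: r_def inner_diff_left inner_commute[of w1 v1]
        inner_commute[of w2 v1] inner_commute[of w1 v2] inner_commute[of w2 v2]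
        inner_commute[of w2 w1])
  have "distinct [v1, v2, w1, w2]" "0 \<notin> {v1, v2, w1, w2}"
    using o by auto
  moreover have "pairwise orthogonal {v1, v2, w1, w2}"
    using o by (auto simp: pairwise_def orthogonal_def inner_commute)
  ultimately have "span {v1, v2, w1, w2} = UNIV"
    using card_eq_dim[of "{v1, v2, w1, w2}" UNIV] pairwise_orthogonal_independent[of "{v1, v2, w1, w2}"]
    by auto
  then have "orthogonal r r"
    by (intro orthogonal_to_span[of r "{v1, v2, w1, w2}" r]) (auto simp: orthogonal_def r)
  then have "n = (n \<bullet> w1) *\<^sub>R w1 + (n \<bullet> w2) *\<^sub>R w2"
    unfolding orthogonal_self r_def by (simp add: algebra_simps)
  then show ?thesis
    by (metis span_add span_base span_mul insertCI)
qed

theorem corollary4p11: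
  fixes f \<phi> X\<alpha> X\<beta> \<xi> :: "real \<times> real \<Rightarrow> real ^ 4"
    and b c bt ct :: "real ^ 4"
  assumes "frame_field \<phi> X\<alpha> X\<beta> \<xi>"
    and "curvature_surface X\<alpha> X\<beta> f"
    and "orthonormal [b, c]"
    and "\<And>y. ((\<lambda>u. X\<alpha> (exp (- u), y)
                 - (cos (sqrt 5 * u / 2) *\<^sub>R b - sin (sqrt 5 * u / 2) *\<^sub>R c)) \<longlongrightarrow> 0) at_top"
    and "orthonormal [bt, ct]"
    and "\<And>x y. (x, y) \<in> D \<Longrightarrow>
           (1 + y\<^sup>2) powr (- 1 / 2) *\<^sub>R (y *\<^sub>R X\<beta> (x, y) - \<phi> (x, y))
           = - sin (y - arctan y) *\<^sub>R bt + cos (y - arctan y) *\<^sub>R ct"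
  shows "(\<exists>p. range (center_A f \<phi> X\<beta> \<xi>) \<subseteq> (+) p ` span {bt, ct}) \<and>
         (\<exists>q. center_A_tilde f X\<alpha> \<xi> ` {0<..} \<subseteq> (+) q ` span {b, c})"
proof -
  define V where "V x y = C2 x *\<^sub>R \<xi> (x, y) - B2 x *\<^sub>R X\<alpha> (x, y)" for x y
  define U where "U x y = y *\<^sub>R X\<beta> (x, y) - \<phi> (x, y)" for x y
  \<comment> \<open>\<open>W y\<close> is \<open>U x y\<close> normalised, but defined by its
    expression in \<open>bt\<close> and \<open>ct\<close>, so that it visibly depends on
    \<open>y\<close> alone.\<close>
  define W where "W y = - sin (y - arctan y) *\<^sub>R bt + cos (y - arctan y) *\<^sub>R ct" for y
  define A where "A x y = f (x, y) - (1 / (2 * sqrt 5 * (1 + y\<^sup>2))) *\<^sub>R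
        (X\<beta> (x, y) - (2 * (1 + y\<^sup>2)) *\<^sub>R \<xi> (x, y) + y *\<^sub>R \<phi> (x, y))" for x y
  define At where "At x y = f (x, y) - inverse ((B2 x)\<^sup>2 + (C2 x)\<^sup>2) *\<^sub>R
        (B2 x *\<^sub>R \<xi> (x, y) + C2 x *\<^sub>R X\<alpha> (x, y))" for x y

  have ortho: "orthonormal [\<phi> (x, y), X\<alpha> (x, y), X\<beta> (x, y), \<xi> (x, y)]" if "x > 0" for x y
    using assms(1) that unfolding frame_field_def D_def by auto
  have pos: "1 + y\<^sup>2 > 0" for y :: real
    by (simp add: add_pos_nonneg)

  \<comment> \<open>Partial derivatives of the frame and of the surface\<close>
  have frame:
    "((\<lambda>s. \<phi> (s, y)) has_vector_derivative - a1 x y *\<^sub>R X\<alpha> (x, y)) (at x)"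
    "((\<lambda>s. \<xi> (s, y)) has_vector_derivative b1 x y *\<^sub>R X\<alpha> (x, y)) (at x)"
    "((\<lambda>s. X\<beta> (s, y)) has_vector_derivative c1 x y *\<^sub>R X\<alpha> (x, y)) (at x)"
    "((\<lambda>t. \<xi> (x, t)) has_vector_derivative b2 x y *\<^sub>R X\<beta> (x, y)) (at y)"
    "((\<lambda>t. X\<alpha> (x, t)) has_vector_derivative c2 x y *\<^sub>R X\<beta> (x, y)) (at y)"
    if "x > 0" for x y
    using assms(1) that unfolding frame_field_def D_def by auto
  have df: "(f has_derivative
           (\<lambda>(dx, dy). ((x\<^sup>2 - y\<^sup>2) / (x * h x y) * dx) *\<^sub>R X\<alpha> (x, y)
                     + (2 * y / h x y * dy) *\<^sub>R X\<beta> (x, y))) (at (x, y))" if "x > 0" for x y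
    using assms(2) that unfolding curvature_surface_def D_def by auto
  have fx: "((\<lambda>s. f (s, y)) has_vector_derivative ((x\<^sup>2 - y\<^sup>2) / (x * h x y)) *\<^sub>R X\<alpha> (x, y)) (at x)"
    if "x > 0" for x y
  proof -
    have "((\<lambda>s. (s, y)) has_derivative (\<lambda>t. (t, 0))) (at x)"
      by (auto intro!: derivative_eq_intros)
    from has_derivative_compose[OF this, of f, OF df[OF that]] show ?thesis
      by (simp add: has_vector_derivative_def mult.commute)
  qed
  have fy: "((\<lambda>t. f (x, t)) has_vector_derivative (2 * y / h x y) *\<^sub>R X\<beta> (x, y)) (at y)"
    if "x > 0" for x y
  proof -
    have "((\<lambda>s. (x, s)) has_derivative (\<lambda>t. (0, t))) (at y)"
      by (auto intro!: derivative_eq_intros)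
    from has_derivative_compose[OF this, of f, OF df[OF that]] show ?thesis
      by (simp add: has_vector_derivative_def mult.commute)
  qed
  \<comment> \<open>The \<open>y\<close>-derivatives of \<open>f\<close>, \<open>\<xi>\<close> and
    \<open>X\<alpha>\<close> are \<open>2 * y / h x y\<close> times \<open>1\<close>,
    \<open>B2 x\<close> and \<open>C2 x\<close>, all along \<open>X\<beta>\<close>. The common
    factor is what makes the combinations \<open>V\<close> and \<open>At\<close> constant in
    \<open>y\<close>.\<close>
  have b2_eq: "b2 x y = 2 * y / h x y * B2 x" and c2_eq: "c2 x y = 2 * y / h x y * C2 x" for x y
    by (simp_all add: b2_def c2_def B2_def C2_def algebra_simps flip: minus_divide_left)

  \<comment> \<open>Quantities that are constant along coordinate curves\<close>
  have const_y: "g y = g z"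
    if g: "\<And>y. (g has_vector_derivative 0) (at y)" for g :: "real \<Rightarrow> real ^ 4" and y z
  proof -
    obtain k where "\<And>x. x \<in> UNIV \<Longrightarrow> g x = k"
      using has_vector_derivative_zero_constant[OF convex_UNIV, of g] g by blast
    then show ?thesis by simp
  qed
  have const_x: "g x = g z"
    if g: "\<And>x. x > 0 \<Longrightarrow> (g has_vector_derivative 0) (at x)" and xz: "x > 0" "z > 0"
    for g :: "real \<Rightarrow> real ^ 4" and x z
  proof -
    have "(g has_vector_derivative 0) (at x within {0<..})" if "x \<in> {0<..}" for x
      using g that by (auto intro: has_vector_derivative_at_within)
    then obtain k where "\<And>x. x \<in> {0<..} \<Longrightarrow> g x = k"
      using has_vector_derivative_zero_constant[OF convex_real_interval(3), of 0 g] by blast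
    then show ?thesis using xz by simp
  qed

  have V_y: "V x y = V x z" if "x > 0" for x y z
  proof (rule const_y)
    show "(V x has_vector_derivative 0) (at y)" for y
      unfolding V_def
      by (rule derivative_eq_intros frame that refl)+ (simp add: b2_eq c2_eq algebra_simps)
  qed
  have At_y: "At x y = At x z" if "x > 0" for x y z
  proof (rule const_y)
    fix y
    define K k where "K = (B2 x)\<^sup>2 + (C2 x)\<^sup>2" and "k = 2 * y / h x y"
    \<comment> \<open>As \<open>inverse 0 = 0\<close>, the cancellation of \<open>K\<close> below
      depends on \<open>B2 x\<close> being nonzero.\<close>
    have "K \<noteq> 0"
      using B2_neg[OF that] by (simp add: K_def sum_power2_eq_zero_iff)
    then have coeff: "k - inverse K * (B2 x * (k * B2 x) + C2 x * (k * C2 x)) = 0"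
      by (simp add: K_def field_simps power2_eq_square)
    have "(At x has_vector_derivative k *\<^sub>R X\<beta> (x, y) - inverse K *\<^sub>R
        (B2 x *\<^sub>R ((k * B2 x) *\<^sub>R X\<beta> (x, y)) + C2 x *\<^sub>R ((k * C2 x) *\<^sub>R X\<beta> (x, y)))) (at y)"
      unfolding At_def K_def[symmetric]
      by (rule derivative_eq_intros frame fy that refl)+ (simp add: b2_eq c2_eq k_def)
    also have "k *\<^sub>R X\<beta> (x, y) - inverse K *\<^sub>R
        (B2 x *\<^sub>R ((k * B2 x) *\<^sub>R X\<beta> (x, y)) + C2 x *\<^sub>R ((k * C2 x) *\<^sub>R X\<beta> (x, y))) =
        (k - inverse K * (B2 x * (k * B2 x) + C2 x * (k * C2 x))) *\<^sub>R X\<beta> (x, y)"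
      by (simp add: algebra_simps)
    finally show "(At x has_vector_derivative 0) (at y)"
      unfolding coeff by simp
  qed
  have A_x: "A x y = A z y" if "x > 0" "z > 0" for x y z
  proof (rule const_x[OF _ that])
    fix x :: real assume x: "x > 0"
    define w where "w = 1 / (2 * sqrt 5 * (1 + y\<^sup>2))"
    \<comment> \<open>The terms with \<open>P\<close> cancel since
      \<open>- 2 + 2 * (1 + y\<^sup>2) - 2 * y\<^sup>2 = 0\<close>; what remains is the coefficient
      of the \<open>x\<close>-derivative of \<open>f\<close>, up to the factor inverted by
      \<open>w\<close>.\<close>
    define m P where "m = 1 / (x * h x y)" and "P = X0 x + sqrt 5 / 2"
    have "a1 x y = 2 * y * m * P" "b1 x y = - m * (P + sqrt 5 * (x\<^sup>2 - y\<^sup>2))" "c1 x y = - 2 * m * P"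
      by (simp_all add: a1_def b1_def c1_def m_def P_def)
    then have "c1 x y - 2 * (1 + y\<^sup>2) * b1 x y - y * a1 x y =
        2 * sqrt 5 * (1 + y\<^sup>2) * (m * (x\<^sup>2 - y\<^sup>2))"
      by algebra
    then have coeff: "(x\<^sup>2 - y\<^sup>2) / (x * h x y)
        - w * (c1 x y - 2 * (1 + y\<^sup>2) * b1 x y - y * a1 x y) = 0"
      using pos[of y] by (simp add: w_def m_def)
    have "((\<lambda>x. A x y) has_vector_derivative ((x\<^sup>2 - y\<^sup>2) / (x * h x y)) *\<^sub>R X\<alpha> (x, y) - w *\<^sub>R
        (c1 x y *\<^sub>R X\<alpha> (x, y) - (2 * (1 + y\<^sup>2)) *\<^sub>R (b1 x y *\<^sub>R X\<alpha> (x, y))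
          + y *\<^sub>R (- a1 x y *\<^sub>R X\<alpha> (x, y)))) (at x)"
      unfolding A_def w_def[symmetric]
      by (rule derivative_eq_intros frame fx x refl)+ simp
    also have "((x\<^sup>2 - y\<^sup>2) / (x * h x y)) *\<^sub>R X\<alpha> (x, y) - w *\<^sub>R
        (c1 x y *\<^sub>R X\<alpha> (x, y) - (2 * (1 + y\<^sup>2)) *\<^sub>R (b1 x y *\<^sub>R X\<alpha> (x, y))
          + y *\<^sub>R (- a1 x y *\<^sub>R X\<alpha> (x, y))) =
        ((x\<^sup>2 - y\<^sup>2) / (x * h x y)
          - w * (c1 x y - 2 * (1 + y\<^sup>2) * b1 x y - y * a1 x y)) *\<^sub>R X\<alpha> (x, y)"
      by (simp add: scaleR_left_diff_distrib right_diff_distrib scaleR_right_diff_distrib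
          scaleR_add_right mult.assoc)
    finally show "((\<lambda>x. A x y) has_vector_derivative 0) (at x)"
      unfolding coeff by simp
  qed

  \<comment> \<open>The plane spanned by the vectors \<open>W y\<close>\<close>
  have U_W: "U x y = sqrt (1 + y\<^sup>2) *\<^sub>R W y" if "x > 0" for x y
  proof -
    have "W y = (1 + y\<^sup>2) powr (- 1 / 2) *\<^sub>R U x y"
      using assms(6)[of x y] that by (simp add: W_def U_def D_def)
    then show ?thesis
      using pos[of y] by (simp add: powr_minus powr_half_sqrt)
  qed
  \<comment> \<open>Two parameters suffice: \<open>W 0\<close> is \<open>ct\<close>, and
    \<open>W 1\<close> has a nonzero component along \<open>bt\<close> because
    \<open>0 < 1 - pi / 4 < pi\<close>.\<close>
  have W_0: "W 0 = ct" and W_1: "W 1 = - sin (1 - pi / 4) *\<^sub>R bt + cos (1 - pi / 4) *\<^sub>R ct"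
    by (simp_all add: W_def)
  have sin_ne: "sin (1 - pi / 4) \<noteq> 0"
    using sin_gt_zero[of "1 - pi / 4"] pi_less_4 pi_gt3 by auto
  have orth_tilde: "n \<bullet> bt = 0 \<and> n \<bullet> ct = 0" if "\<And>y. n \<bullet> W y = 0" for n
    using that[of 0] that[of 1] sin_ne by (auto simp: W_0 W_1 inner_add_right inner_diff_right)

  \<comment> \<open>The plane of \<open>b\<close> and \<open>c\<close> as the limit of the vectors
    \<open>V\<close>\<close>
  have orth_inf: "n \<bullet> b = 0 \<and> n \<bullet> c = 0" if n: "\<And>x. x > 0 \<Longrightarrow> n \<bullet> V x 0 = 0" for n
  proof -
    define T where "T u = n \<bullet> (cos (sqrt 5 * u / 2) *\<^sub>R b - sin (sqrt 5 * u / 2) *\<^sub>R c)" for u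
    \<comment> \<open>Solving \<open>n \<bullet> V x 0 = 0\<close> for \<open>X\<alpha>\<close>
      leaves a bounded factor times \<open>C2 / B2\<close>, which vanishes in the limit.\<close>
    have X\<alpha>_eq: "n \<bullet> X\<alpha> (x, 0) = C2 x / B2 x * (n \<bullet> \<xi> (x, 0))" if "x > 0" for x
      using n[OF that] B2_neg[OF that] by (simp add: V_def inner_diff_right field_simps)
    have "filterlim (\<lambda>u :: real. exp (- u)) (at_right 0) at_top"
      by (auto simp: filterlim_at intro!: filterlim_compose[OF exp_at_bot] filterlim_uminus_at_bot_at_top)
    then have lim: "((\<lambda>u. C2 (exp (- u)) / B2 (exp (- u))) \<longlongrightarrow> 0) at_top"
      using C2_over_B2_tendsto_0 filterlim_compose by blast
    have "((\<lambda>u. n \<bullet> X\<alpha> (exp (- u), 0)) \<longlongrightarrow> 0) at_top"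
    proof (rule Lim_null_comparison)
      show "((\<lambda>u. norm n * \<bar>C2 (exp (- u)) / B2 (exp (- u))\<bar>) \<longlongrightarrow> 0) at_top"
        by (intro tendsto_mult_right_zero tendsto_rabs_zero lim)
      have "norm (n \<bullet> X\<alpha> (exp (- u), 0)) \<le> norm n * \<bar>C2 (exp (- u)) / B2 (exp (- u))\<bar>" for u
      proof -
        have "norm (\<xi> (exp (- u), 0)) = 1"
          using orthonormal_4[OF ortho[of "exp (- u)" 0]] by (simp add: norm_eq_1)
        then have "\<bar>n \<bullet> \<xi> (exp (- u), 0)\<bar> \<le> norm n"
          using Cauchy_Schwarz_ineq2[of n "\<xi> (exp (- u), 0)"] by simp
        then show ?thesis
          using mult_right_mono[of "\<bar>n \<bullet> \<xi> (exp (- u), 0)\<bar>" "norm n"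
            "\<bar>C2 (exp (- u)) / B2 (exp (- u))\<bar>"]
          by (simp add: X\<alpha>_eq abs_mult mult.commute)
      qed
      then show "\<forall>\<^sub>F u in at_top. norm (n \<bullet> X\<alpha> (exp (- u), 0))
          \<le> norm n * \<bar>C2 (exp (- u)) / B2 (exp (- u))\<bar>"
        by simp
    qed
    moreover have "((\<lambda>u. n \<bullet> (X\<alpha> (exp (- u), 0)
        - (cos (sqrt 5 * u / 2) *\<^sub>R b - sin (sqrt 5 * u / 2) *\<^sub>R c))) \<longlongrightarrow> 0) at_top"
      using tendsto_inner[OF tendsto_const[of n] assms(4)[of 0]] by simp
    ultimately have T: "(T \<longlongrightarrow> 0) at_top"
      using tendsto_diff[of "\<lambda>u. n \<bullet> X\<alpha> (exp (- u), 0)" 0 at_top] 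
      unfolding T_def by (fastforce simp: inner_diff_right)
    \<comment> \<open>\<open>T\<close> has period \<open>4 * pi / sqrt 5\<close>; a periodic
      function with limit \<open>0\<close> at infinity is zero.\<close>
    have T_zero: "T s = 0" for s
    proof -
      define u where "u m = s + real m * (4 * pi / sqrt 5)" for m
      have "T (u m) = T s" for m
      proof -
        have "sqrt 5 * u m / 2 = sqrt 5 * s / 2 + 2 * real m * pi"
          by (simp add: u_def field_simps)
        then show ?thesis
          unfolding T_def by (simp only: sin_add cos_add sin_2npi cos_2npi) simp
      qed
      moreover have "filterlim u at_top sequentially"
        unfolding u_def
        by (intro filterlim_tendsto_add_at_top[OF tendsto_const]
            filterlim_at_top_mult_tendsto_pos[OF tendsto_const] filterlim_real_sequentially) auto
      then have "(\<lambda>m. T (u m)) \<longlonglongrightarrow> 0"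
        by (rule filterlim_compose[OF T])
      ultimately show ?thesis
        by (simp add: LIMSEQ_const_iff)
    qed
    \<comment> \<open>At \<open>u = pi / sqrt 5\<close> the angle is \<open>pi / 2\<close>, which
      isolates \<open>c\<close>.\<close>
    have "T 0 = n \<bullet> b" "T (pi / sqrt 5) = - (n \<bullet> c)"
      by (simp_all add: T_def)
    then show ?thesis
      by (simp add: T_zero)
  qed

  \<comment> \<open>Orthogonality of the two planes\<close>
  have U_V: "U x y \<bullet> V x y = 0" if "x > 0" for x y
    using orthonormal_4[OF ortho[OF that, of y]]
    by (simp add: U_def V_def inner_diff_left inner_diff_right)
  have W_V: "W y \<bullet> V x z = 0" if "x > 0" for x y z
    using U_V[OF that, of y] pos[of y] unfolding U_W[OF that] V_y[OF that, of y z] by simp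
  have "bt \<bullet> V x 0 = 0 \<and> ct \<bullet> V x 0 = 0" if "x > 0" for x
    using orth_tilde[of "V x 0"] W_V[OF that] by (simp add: inner_commute)
  then have orth: "bt \<bullet> b = 0" "bt \<bullet> c = 0" "ct \<bullet> b = 0" "ct \<bullet> c = 0"
    using orth_inf by blast+

  \<comment> \<open>The centers of the spheres containing the \<open>x\<close>-curves\<close>
  have A_plane: "A 1 y - A 1 0 \<in> span {bt, ct}" for y
  proof -
    have "(A 1 y - A 1 0) \<bullet> V x 0 = 0" if x: "x > 0" for x
    proof -
      \<comment> \<open>With \<open>V x 0\<close> moved to \<open>V x y\<close>, the frame at
        \<open>(x, y)\<close> applies: \<open>X\<beta>\<close> and \<open>\<phi>\<close> are
        orthogonal to \<open>V\<close>, \<open>\<xi> \<bullet> V = C2 x\<close>, and the factor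
        \<open>1 + y\<^sup>2\<close> cancels.\<close>
      have A_V: "A x y \<bullet> V x 0 = f (x, y) \<bullet> V x 0 + C2 x / sqrt 5" for y
      proof -
        define r where "r = 1 + y\<^sup>2"
        have "r \<noteq> 0"
          using pos[of y] by (simp add: r_def)
        then show ?thesis
          using orthonormal_4[OF ortho[OF x, of y]] unfolding V_y[OF x, of 0 y] A_def r_def[symmetric]
          by (simp add: V_def inner_add_left inner_diff_left inner_diff_right distrib_left)
      qed
      have "((\<lambda>y. f (x, y) \<bullet> V x 0) has_real_derivative 0) (at y)" for y
      proof -
        have "X\<beta> (x, y) \<bullet> V x 0 = 0"
          using orthonormal_4[OF ortho[OF x, of y]] unfolding V_y[OF x, of 0 y]
          by (simp add: V_def inner_diff_right)
        then show ?thesis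
          using has_derivative_inner_left[OF fy[OF x, of y, unfolded has_vector_derivative_def], of "V x 0"]
          by (simp add: has_field_derivative_def lambda_zero)
      qed
      then have "f (x, y) \<bullet> V x 0 = f (x, 0) \<bullet> V x 0"
        using DERIV_isconst_all[of "\<lambda>y. f (x, y) \<bullet> V x 0" y 0] by blast
      \<comment> \<open>\<open>A_x\<close> moves the base point from \<open>1\<close> to the given
        \<open>x\<close>, so one difference of centers is tested against every
        \<open>V x 0\<close>.\<close>
      then show ?thesis
        using A_V[of y] A_V[of 0] A_x[of 1 x] x by (simp add: inner_diff_left)
    qed
    from orth_inf[OF this] show ?thesis
      using orth assms(3,5)
      by (intro in_span_if_orthogonal_complement[of b c bt ct]) (simp_all add: inner_commute)
  qed

  \<comment> \<open>The centers of the spheres containing the \<open>y\<close>-curves\<close>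
  have At_plane: "At x 0 - At 1 0 \<in> span {b, c}" if x: "x > 0" for x
  proof -
    have "(At x 0 - At 1 0) \<bullet> W y = 0" for y
    proof -
      have perp: "X\<alpha> (x, y) \<bullet> W y = 0 \<and> \<xi> (x, y) \<bullet> W y = 0" if x: "x > 0" for x
      proof -
        have "X\<alpha> (x, y) \<bullet> U x y = 0" "\<xi> (x, y) \<bullet> U x y = 0"
          using orthonormal_4[OF ortho[OF x, of y]] by (simp_all add: U_def inner_diff_right)
        then show ?thesis
          using pos[of y] by (simp add: U_W[OF x])
      qed
      \<comment> \<open>The correction term of \<open>At\<close> lies in the span of
        \<open>\<xi>\<close> and \<open>X\<alpha>\<close>, both orthogonal to \<open>W y\<close>, so
        only \<open>f\<close> contributes.\<close>
      have At_W: "At x 0 \<bullet> W y = f (x, y) \<bullet> W y" if "x > 0" for x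
        using perp[OF that] unfolding At_y[OF that, of 0 y]
        by (simp add: At_def inner_add_left inner_diff_left)
      have "((\<lambda>x. f (x, y) \<bullet> W y) has_real_derivative 0) (at x)" if x: "x > 0" for x
        using has_derivative_inner_left[OF fx[OF x, of y, unfolded has_vector_derivative_def], of "W y"]
          perp[OF x]
        by (simp add: has_field_derivative_def lambda_zero)
      then have "f (x, y) \<bullet> W y = f (1, y) \<bullet> W y"
        using has_field_derivative_zero_constant[OF convex_real_interval(3), of 0 "\<lambda>x. f (x, y) \<bullet> W y"] x
        by (metis greaterThan_iff has_field_derivative_at_within zero_less_one)
      then show ?thesis
        using At_W[OF x] At_W[of 1] by (simp add: inner_diff_left)
    qed
    from orth_tilde[OF this] show ?thesis
      using orth assms(3,5)
      by (intro in_span_if_orthogonal_complement[of bt ct b c]) (simp_all add: inner_commute)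
  qed

  \<comment> \<open>Constancy in \<open>x\<close> gives existence for the description; any single
    instance, here \<open>x = 1\<close>, gives uniqueness.\<close>
  have "center_A f \<phi> X\<beta> \<xi> y = A 1 y" for y
    unfolding center_A_def A_def[symmetric]
  proof (rule the_equality)
    show "\<forall>x>0. A 1 y = A x y"
      using A_x[OF zero_less_one] by blast
  qed simp
  then have "range (center_A f \<phi> X\<beta> \<xi>) \<subseteq> (+) (A 1 0) ` span {bt, ct}"
    using A_plane by (auto intro!: image_eqI[where x = "A 1 _ - A 1 0"])
  moreover have "center_A_tilde f X\<alpha> \<xi> x = At x 0" if "x > 0" for x
    unfolding center_A_tilde_def At_def[symmetric]
  proof (rule the_equality)
    show "\<forall>y. At x 0 = At x y"
      using At_y[OF that] by blast
  qed simp
  then have "center_A_tilde f X\<alpha> \<xi> ` {0<..} \<subseteq> (+) (At 1 0) ` span {b, c}"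
    using At_plane by (auto intro!: image_eqI[where x = "At _ 0 - At 1 0"])
  ultimately show ?thesis
    by blast
qed

end
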